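(* Let $k$ be a field, let $G\subset S_m$ be a subgroup, and let $H$ be a finite group acting on the polynomial ring $k[y_1,\ldots,y_n]$ by $k$-algebra morphisms such that $h\cdot y_j=\sum_{1\le l\le n}b_{lj}(h)\,y_l$ for all $h\in H$, $1\le j\le n$, where $(b_{lj}(h))_{1\le l,j\le n}\in GL_n(k)$. Let $\widetilde{G}:=H\wr_{X_m}G$, where $X_m=\{1,\ldots,m\}$, act on the polynomial ring $k[x_{ij}:1\le i\le m,1\le j\le n]$ by $k$-algebra automorphisms determined by $$g: x_{ij}\mapsto x_{g(i),j},\qquad \alpha^{(l)}(h): x_{ij}\mapsto\begin{cases}x_{ij}, & i\ne l,\\ \sum_{1\le t\le n}b_{tj}(h)\,x_{lt}, & i=l,\end{cases}$$ for $g\in G$, $h\in H$, $1\le l\le m$. Assume that $\gcd\{|G|,\operatorname{char}k\}=1$ (i.e. $\operatorname{char}k=0$ or $\operatorname{char}k$ does not divide $|G|$). Suppose that $k[y_1,\ldots,y_n]^H=k[F_1(y),\ldots,F_N(y)]$ where $F_t(y)=F_t(y_1,\ldots,y_n)\in k[y_1,\ldots,y_n]$ for $1\le t\le N$ ($N$ some integer $\ge n$). Let $G$ act on the polynomial ring $k[X_{it}:1\le i\le m,1\le t\le N]$ by $k$-algebra automorphisms $g(X_{it})=X_{g(i),t}$ for $g\in G$, $1\le i\le m$, $1\le t\le N$. Define a $k$-algebra morphism $$\Phi: k[X_{it}:1\le i\le m,1\le t\le N]\to k[F_1(x_{i1},\ldots,x_{in}),\ldots,F_N(x_{i1},\ldots,x_{in}):1\le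 i\le m]$$ by $\Phi(X_{it})=F_t(x_{i1},\ldots,x_{in})$. If $k[X_{it}:1\le i\le m,1\le t\le N]^G=k[H_1(X),\ldots,H_M(X)]$ where $H_s(X)\in k[X_{it}:1\le i\le m,1\le t\le N]$ for $1\le s\le M$, then $$k[x_{ij}:1\le i\le m,1\le j\le n]^{\widetilde{G}}=k[\Phi(H_1(X)),\ldots,\Phi(H_M(X))].$$
   Context: Wreath product: let $G$ act on $X_m=\{1,\ldots,m\}$ from the left and let $H$ be a group. Let $A=\prod_{1\le i\le m}H$ be the group of all functions $\alpha:X_m\to H$ with pointwise multiplication; $G$ acts on $A$ by $({}^{g}\alpha)(x)=\alpha(g^{-1}\cdot x)$. The wreath product $H\wr_{X_m}G$ is the semi-direct product $A\rtimes G$ with multiplication $(\alpha;g_1)\cdot(\beta;g_2)=(\alpha\cdot{}^{g_1}\beta;\,g_1g_2)$; $G$ and $A$ are identified with subgroups of it. For $1\le l\le m$ and $h\in H$, $\alpha^{(l)}(h)\in A$ denotes the function with $(\alpha^{(l)}(h))(l)=h$ and $(\alpha^{(l)}(h))(i)=1$ for $i\ne l$. The elements $\alpha^{(l)}(h)$ ($1\le l\le m$, $h\in H$) and $g\in G$ generate $H\wr_{X_m}G$. For a group $\Gamma$ acting on a ring $R$, $R^\Gamma$ is the ring of elements fixed by all of $\Gamma$. The notation $k[a_1,\ldots,a_r]$ for elements $a_i$ of a $k$-algebra means the $k$-subalgebra they generate. *)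

theory Defs
  imports
    "HOL-Library.Poly_Mapping"
    "HOL-Algebra.Sym_Groups"
    "HOL-Algebra.Group_Action"
    "HOL-Algebra.Product_Groups"
    "Jordan_Normal_Form.Matrix"
begin

section \<open>Multivariate polynomials\<close>

text \<open>A polynomial maps each monomial (a finitely supported exponent vector) to its
  coefficient; the ring structure is the convolution product of \<open>Poly_Mapping\<close>.\<close>

type_synonym ('v, 'k) mpoly = "('v \<Rightarrow>\<^sub>0 nat) \<Rightarrow>\<^sub>0 'k"

definition Const :: "'k \<Rightarrow> ('v, 'k::field) mpoly" where
  "Const c = Poly_Mapping.single 0 c"

definition Var :: "'v \<Rightarrow> ('v, 'k::field) mpoly" where
  "Var v = Poly_Mapping.single (Poly_Mapping.single v 1) 1"

text \<open>The polynomial ring \<open>k[v : v \<in> V]\<close>, as a subset of all polynomials over the type of variables.\<close>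

definition polys :: "'v set \<Rightarrow> ('v, 'k::field) mpoly set" where
  "polys V = {p. \<forall>e \<in> Poly_Mapping.keys p. Poly_Mapping.keys e \<subseteq> V}"

text \<open>The \<open>k\<close>-algebra morphism sending each variable \<open>v\<close> to \<open>f v\<close>.\<close>

definition mpoly_subst :: "('v \<Rightarrow> ('w, 'k) mpoly) \<Rightarrow> ('v, 'k::field) mpoly \<Rightarrow> ('w, 'k) mpoly" where
  "mpoly_subst f p =
     (\<Sum>e \<in> Poly_Mapping.keys p.
        Const (Poly_Mapping.lookup p e) *
        (\<Prod>v \<in> Poly_Mapping.keys e. f v ^ Poly_Mapping.lookup e v))"

text \<open>\<open>k[S]\<close>, the \<open>k\<close>-subalgebra generated by \<open>S\<close>.\<close>

inductive_set alg_gen :: "('v, 'k::field) mpoly set \<Rightarrow> ('v, 'k) mpoly set"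
  for S :: "('v, 'k) mpoly set" where
  const: "Const c \<in> alg_gen S"
| gen: "p \<in> S \<Longrightarrow> p \<in> alg_gen S"
| add: "p \<in> alg_gen S \<Longrightarrow> q \<in> alg_gen S \<Longrightarrow> p + q \<in> alg_gen S"
| mult: "p \<in> alg_gen S \<Longrightarrow> q \<in> alg_gen S \<Longrightarrow> p * q \<in> alg_gen S"


section \<open>Group actions by algebra automorphisms\<close>

definition alg_hom ::
  "('v, 'k::field) mpoly set \<Rightarrow> ('w, 'k) mpoly set \<Rightarrow> (('v, 'k) mpoly \<Rightarrow> ('w, 'k) mpoly) \<Rightarrow> bool" where
  "alg_hom A B f \<longleftrightarrow>
     f \<in> A \<rightarrow> B \<and> (\<forall>c. f (Const c) = Const c) \<and>
     (\<forall>p \<in> A. \<forall>q \<in> A. f (p + q) = f p + f q \<and> f (p * q) = f p * f q)"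

text \<open>Bijectivity is part of \<^locale>\<open>group_action\<close>, so each group element acts by an automorphism.\<close>

definition alg_action ::
  "('g, 'z) monoid_scheme \<Rightarrow> ('v, 'k::field) mpoly set \<Rightarrow>
   ('g \<Rightarrow> ('v, 'k) mpoly \<Rightarrow> ('v, 'k) mpoly) \<Rightarrow> bool" where
  "alg_action \<Gamma> R \<phi> \<longleftrightarrow> group_action \<Gamma> R \<phi> \<and> (\<forall>g \<in> carrier \<Gamma>. alg_hom R R (\<phi> g))"

definition fixed_ring :: "('g, 'z) monoid_scheme \<Rightarrow> 'r set \<Rightarrow> ('g \<Rightarrow> 'r \<Rightarrow> 'r) \<Rightarrow> 'r set" where
  "fixed_ring \<Gamma> R \<phi> = {p \<in> R. \<forall>g \<in> carrier \<Gamma>. \<phi> g p = p}"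


section \<open>Wreath products\<close>

text \<open>The wreath product of \<open>H\<close> with \<open>G\<close>, where \<open>G\<close> acts on \<open>X\<close> from the left by \<open>\<psi>\<close>;
  the base group consists of the functions from \<open>X\<close> to \<open>H\<close>, extended by \<open>undefined\<close> outside \<open>X\<close>.\<close>

definition base_act ::
  "'x set \<Rightarrow> ('g, 'z) monoid_scheme \<Rightarrow> ('g \<Rightarrow> 'x \<Rightarrow> 'x) \<Rightarrow> 'g \<Rightarrow> ('x \<Rightarrow> 'h) \<Rightarrow> 'x \<Rightarrow> 'h" where
  "base_act X G \<psi> g \<alpha> = (\<lambda>x\<in>X. \<alpha> (\<psi> (inv\<^bsub>G\<^esub> g) x))"

definition wreath_product ::
  "('h, 'y) monoid_scheme \<Rightarrow> 'x set \<Rightarrow> ('g, 'z) monoid_scheme \<Rightarrow> ('g \<Rightarrow> 'x \<Rightarrow> 'x) \<Rightarrow>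
   (('x \<Rightarrow> 'h) \<times> 'g) monoid" where
  "wreath_product H X G \<psi> =
     (let A = product_group X (\<lambda>_. H) in
       \<lparr>carrier = carrier A \<times> carrier G,
        mult = (\<lambda>(\<alpha>, g\<^sub>1) (\<beta>, g\<^sub>2). (\<alpha> \<otimes>\<^bsub>A\<^esub> base_act X G \<psi> g\<^sub>1 \<beta>, g\<^sub>1 \<otimes>\<^bsub>G\<^esub> g\<^sub>2)),
        one = (\<one>\<^bsub>A\<^esub>, \<one>\<^bsub>G\<^esub>)\<rparr>)"

definition wreath_top :: "('h, 'y) monoid_scheme \<Rightarrow> 'x set \<Rightarrow> 'g \<Rightarrow> ('x \<Rightarrow> 'h) \<times> 'g" where
  "wreath_top H X g = (\<one>\<^bsub>product_group X (\<lambda>_. H)\<^esub>, g)"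

text \<open>The element \<open>\<alpha>\<^sup>(\<^sup>l\<^sup>)(h)\<close> of the base group, inside the wreath product.\<close>

definition wreath_base ::
  "('h, 'y) monoid_scheme \<Rightarrow> 'x set \<Rightarrow> ('g, 'z) monoid_scheme \<Rightarrow> 'x \<Rightarrow> 'h \<Rightarrow> ('x \<Rightarrow> 'h) \<times> 'g" where
  "wreath_base H X G l h = ((\<lambda>i\<in>X. if i = l then h else \<one>\<^bsub>H\<^esub>), \<one>\<^bsub>G\<^esub>)"


section \<open>The substitution homomorphism\<close>

text \<open>\<open>F(x\<^sub>i\<^sub>1, \<dots>, x\<^sub>i\<^sub>n)\<close> for a polynomial \<open>F\<close> in \<open>y\<^sub>1, \<dots>, y\<^sub>n\<close>.\<close>

definition in_block :: "nat \<Rightarrow> (nat, 'k::field) mpoly \<Rightarrow> (nat \<times> nat, 'k) mpoly" where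
  "in_block i F = mpoly_subst (\<lambda>j. Var (i, j)) F"

definition Phi ::
  "(nat \<Rightarrow> (nat, 'k::field) mpoly) \<Rightarrow> (nat \<times> nat, 'k) mpoly \<Rightarrow> (nat \<times> nat, 'k) mpoly" where
  "Phi F = mpoly_subst (\<lambda>(i, t). in_block i (F t))"

end

theory Submission
  imports Defs
begin

text \<open>Being invariant under the wreath product means being invariant under every
  \<open>\<alpha>\<^sup>(\<^sup>l\<^sup>)(h)\<close> and every \<open>g \<in> G\<close>, because these elements generate it
  (\<open>fixed_ring_wreath_product\<close>). The two kinds of invariance are treated in turn.

  The invariants of the base group \<open>H\<^sup>m\<close> are the polynomials in the \<open>F\<^sub>t(x\<^sub>i)\<close>, that is, the image of
  \<open>\<Phi>\<close>. The characteristic of \<open>k\<close> may divide \<open>|H|\<close>, so averaging over \<open>H\<close> is not possible. Linear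
  algebra over the field replaces it: choose any \<open>k\<close>-linear projection \<open>\<pi>\<close> of \<open>k[y]\<close> onto the subspace
  \<open>k[y]\<^sup>H\<close> and let \<open>\<pi>\<close> act on the \<open>l\<close>-th block of variables \<open>x\<^sub>l\<^sub>1, \<dots>, x\<^sub>l\<^sub>n\<close> with the other variables
  as scalars. Writing \<open>p = \<Sum>\<^sub>u u \<cdot> c\<^sub>u(x\<^sub>l)\<close> with \<open>u\<close> running over the monomials in the other variables,
  \<open>p\<close> is invariant under all \<open>\<alpha>\<^sup>(\<^sup>l\<^sup>)(h)\<close> iff every \<open>c\<^sub>u\<close> is \<open>H\<close>-invariant, and then the projection on
  block \<open>l\<close> fixes \<open>p\<close> (\<open>blockwise_fixed_iff\<close>). So an invariant \<open>p\<close> equals the polynomial obtained by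
  applying \<open>\<pi>\<close> to each block in turn; this turns each monomial \<open>\<Prod>\<^sub>i u\<^sub>i(x\<^sub>i)\<close> of \<open>p\<close> into
  \<open>\<Prod>\<^sub>i (\<pi> u\<^sub>i)(x\<^sub>i)\<close> (\<open>blockwise_fixed_expansion\<close>), a product of \<open>H\<close>-invariants of the single blocks
  (\<open>blockwise_invariants\<close>).

  The map \<open>\<Phi>\<close> commutes with the two actions of \<open>G\<close>. If \<open>\<Phi>(q)\<close> is \<open>G\<close>-invariant, averaging \<open>q\<close> over
  \<open>G\<close>, whose order is invertible in \<open>k\<close>, yields a \<open>G\<close>-invariant with the same image
  (\<open>invariant_image_by_averaging\<close>). Hence the invariants of the wreath product are the image under
  \<open>\<Phi>\<close> of \<open>k[P\<^sub>1, \<dots>, P\<^sub>M]\<close>, which is \<open>k[\<Phi>(P\<^sub>1), \<dots>, \<Phi>(P\<^sub>M)]\<close>.\<close>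

section \<open>Linear maps of polynomial rings\<close>

definition Mon :: "('v \<Rightarrow>\<^sub>0 nat) \<Rightarrow> ('v, 'k::field) mpoly" where
  "Mon e = Poly_Mapping.single e 1"

lemma Const_0 [simp]: "Const 0 = 0"
  by (simp add: Const_def)

lemma Const_1 [simp]: "Const 1 = 1"
  by (simp add: Const_def)

lemma Const_add: "Const (a + b) = Const a + Const b"
  by (simp add: Const_def single_add)

lemma Const_mult: "Const (a * b) = Const a * Const b"
  by (simp add: Const_def mult_single)

lemma Const_of_nat: "Const (of_nat n) = of_nat n"
  by (simp add: Const_def)

lemma Mon_zero [simp]: "Mon 0 = 1"
  by (simp add: Mon_def)

lemma Mon_add: "Mon (d + e) = Mon d * Mon e"
  by (simp add: Mon_def mult_single)

lemma Mon_sum: "finite A \<Longrightarrow> Mon (sum f A) = (\<Prod>a\<in>A. Mon (f a))"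
  by (induction A rule: finite_induct) (simp_all add: Mon_add)

lemma Mon_single: "Mon (Poly_Mapping.single v k) = Var v ^ k"
proof (induction k)
  case (Suc k)
  have "Poly_Mapping.single v (Suc k) = Poly_Mapping.single v 1 + Poly_Mapping.single v k"
    by (simp flip: single_add)
  then show ?case
    by (simp add: Mon_add Suc) (simp add: Mon_def Var_def)
qed simp

lemma lookup_Const_mult [simp]:
  "Poly_Mapping.lookup (Const c * p) e = c * Poly_Mapping.lookup p e"
  unfolding Const_def mult_map_scale_conv_mult[symmetric]
  by (simp add: map.rep_eq when_def)

lemma lookup_Mon: "Poly_Mapping.lookup (Mon e) d = (if d = e then 1 else 0)"
  by (simp add: Mon_def lookup_single when_def)

lemma exponent_expansion:
  "(e :: 'v \<Rightarrow>\<^sub>0 nat) =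
     (\<Sum>v\<in>Poly_Mapping.keys e. Poly_Mapping.single v (Poly_Mapping.lookup e v))"
  by (rule poly_mapping_eqI) (simp add: lookup_sum lookup_single when_def in_keys_iff)

lemma Mon_eq_prod: "Mon e = (\<Prod>v\<in>Poly_Mapping.keys e. Var v ^ Poly_Mapping.lookup e v)"
  by (subst exponent_expansion) (simp only: Mon_sum finite_keys Mon_single)

lemma Mon_expansion:
  "p = (\<Sum>e\<in>Poly_Mapping.keys p. Const (Poly_Mapping.lookup p e) * Mon e)"
  by (rule poly_mapping_eqI) (simp add: lookup_sum lookup_Mon in_keys_iff if_distrib cong: if_cong)

definition klinear :: "(('v, 'k::field) mpoly \<Rightarrow> ('w, 'k) mpoly) \<Rightarrow> bool" where
  "klinear L \<longleftrightarrow> (\<forall>p q. L (p + q) = L p + L q) \<and> (\<forall>c p. L (Const c * p) = Const c * L p)"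

lemma klinear_zero: "klinear L \<Longrightarrow> L 0 = 0"
  unfolding klinear_def by (metis Const_0 mult_zero_left)

lemma klinear_sum: "klinear L \<Longrightarrow> L (sum f A) = (\<Sum>a\<in>A. L (f a))"
  by (induction A rule: infinite_finite_induct)
     (use klinear_zero[of L] in \<open>simp_all add: klinear_def\<close>)

lemma klinear_expansion:
  assumes "klinear L"
  shows "L p = (\<Sum>e\<in>Poly_Mapping.keys p. Const (Poly_Mapping.lookup p e) * L (Mon e))"
proof -
  have "L p = L (\<Sum>e\<in>Poly_Mapping.keys p. Const (Poly_Mapping.lookup p e) * Mon e)"
    by (simp flip: Mon_expansion)
  then show ?thesis
    using assms by (simp only: klinear_sum[OF assms]) (simp add: klinear_def)
qed

text \<open>The monomials span the polynomials. Restricting the hypothesis to the monomials of \<open>p\<close> makes it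
  possible to exploit that \<open>p\<close> lies in a subring \<open>polys V\<close>.\<close>

lemma klinear_eqI:
  assumes "klinear L" "klinear L'" and "\<And>e. e \<in> Poly_Mapping.keys p \<Longrightarrow> L (Mon e) = L' (Mon e)"
  shows "L p = L' p"
  by (simp add: klinear_expansion[OF assms(1), of p] klinear_expansion[OF assms(2), of p] assms(3))

lemma klinear_comp: "klinear L \<Longrightarrow> klinear L' \<Longrightarrow> klinear (\<lambda>p. L (L' p))"
  by (simp add: klinear_def)

lemma klinear_mult_left: "klinear L \<Longrightarrow> klinear (\<lambda>p. q * L p)"
  by (simp add: klinear_def distrib_left mult.left_commute)

lemma klinear_id: "klinear (\<lambda>p. p)"
  by (simp add: klinear_def)

definition lin_ext :: "(('v \<Rightarrow>\<^sub>0 nat) \<Rightarrow> ('w, 'k) mpoly) \<Rightarrow> ('v, 'k::field) mpoly \<Rightarrow> ('w, 'k) mpoly" where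
  "lin_ext \<phi> p = (\<Sum>e\<in>Poly_Mapping.keys p. Const (Poly_Mapping.lookup p e) * \<phi> e)"

lemma lin_ext_superset:
  assumes "finite A" "Poly_Mapping.keys p \<subseteq> A"
  shows "lin_ext \<phi> p = (\<Sum>e\<in>A. Const (Poly_Mapping.lookup p e) * \<phi> e)"
  unfolding lin_ext_def using assms
  by (intro sum.mono_neutral_left) (auto simp: in_keys_iff)

lemma klinear_lin_ext: "klinear (lin_ext \<phi>)"
  unfolding klinear_def
proof (intro conjI allI)
  fix p q :: "('a, 'b) mpoly" and c :: 'b
  let ?A = "Poly_Mapping.keys p \<union> Poly_Mapping.keys q"
  show "lin_ext \<phi> (p + q) = lin_ext \<phi> p + lin_ext \<phi> q"
    using Poly_Mapping.keys_add[of p q]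
    by (simp add: lin_ext_superset[of ?A] lookup_add Const_add distrib_right sum.distrib)
  have "Poly_Mapping.keys (Const c * p) \<subseteq> Poly_Mapping.keys p"
    by (auto simp: in_keys_iff)
  then show "lin_ext \<phi> (Const c * p) = Const c * lin_ext \<phi> p"
    by (simp add: lin_ext_superset[of "Poly_Mapping.keys p"] Const_mult sum_distrib_left mult.assoc)
qed

lemma lin_ext_Mon [simp]: "lin_ext \<phi> (Mon e) = \<phi> e"
  by (simp add: lin_ext_def Mon_def)

text \<open>Every subspace of a vector space has a complement. This projection plays the
  part of the Reynolds operator of a finite group.\<close>

lemma klinear_projection:
  fixes V :: "('v, 'k::field) mpoly set"
  assumes "0 \<in> V" and "\<And>p q. p \<in> V \<Longrightarrow> q \<in> V \<Longrightarrow> p + q \<in> V"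
    and "\<And>c p. p \<in> V \<Longrightarrow> Const c * p \<in> V"
  shows "\<exists>\<pi>. klinear \<pi> \<and> (\<forall>p. \<pi> p \<in> V) \<and> (\<forall>p\<in>V. \<pi> p = p)"
proof -
  interpret vector_space "\<lambda>(c::'k) (p::('v, 'k) mpoly). Const c * p"
    by standard (simp_all add: Const_add Const_mult algebra_simps)
  interpret pair: vector_space_pair "\<lambda>(c::'k) (p::('v, 'k) mpoly). Const c * p"
      "\<lambda>(c::'k) (p::('v, 'k) mpoly). Const c * p"
    by unfold_locales
  have lin: "Vector_Spaces.linear (\<lambda>(c::'k) (p::('v, 'k) mpoly). Const c * p)
      (\<lambda>(c::'k) (p::('v, 'k) mpoly). Const c * p) L \<longleftrightarrow> klinear L" for L
    by (simp add: Vector_Spaces.linear_iff klinear_def vector_space_axioms)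
  have "subspace V"
    using assms by (simp add: subspace_def)
  then obtain \<pi> where "range \<pi> \<subseteq> V" "klinear \<pi>" "\<forall>p\<in>V. \<pi> p = p"
    using pair.linear_exists_left_inverse_on[of "\<lambda>p. p" V] unfolding lin
    by (auto simp: klinear_id)
  then show ?thesis
    by blast
qed

section \<open>Substitutions as algebra morphisms\<close>

lemma alg_hom_UNIV_iff:
  "alg_hom UNIV UNIV f \<longleftrightarrow> (\<forall>c. f (Const c) = Const c) \<and>
     (\<forall>p q. f (p + q) = f p + f q) \<and> (\<forall>p q. f (p * q) = f p * f q)"
  by (auto simp: alg_hom_def)

lemma alg_hom_Const: "alg_hom A B f \<Longrightarrow> f (Const c) = Const c"
  and alg_hom_add: "alg_hom A B f \<Longrightarrow> p \<in> A \<Longrightarrow> q \<in> A \<Longrightarrow> f (p + q) = f p + f q"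
  and alg_hom_mult: "alg_hom A B f \<Longrightarrow> p \<in> A \<Longrightarrow> q \<in> A \<Longrightarrow> f (p * q) = f p * f q"
  by (simp_all add: alg_hom_def)

lemma alg_hom_mono: "alg_hom A B f \<Longrightarrow> A' \<subseteq> A \<Longrightarrow> B \<subseteq> B' \<Longrightarrow> alg_hom A' B' f"
  unfolding alg_hom_def by blast

lemma alg_hom_comp: "alg_hom A B f \<Longrightarrow> alg_hom B C g \<Longrightarrow> alg_hom A C (\<lambda>p. g (f p))"
  unfolding alg_hom_def by (auto simp: Pi_iff)

lemma mpoly_subst_eq_lin_ext:
  "mpoly_subst f = lin_ext (\<lambda>e. \<Prod>v\<in>Poly_Mapping.keys e. f v ^ Poly_Mapping.lookup e v)"
  by (simp add: fun_eq_iff mpoly_subst_def lin_ext_def)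

lemma mpoly_subst_Mon:
  "mpoly_subst f (Mon e) = (\<Prod>v\<in>Poly_Mapping.keys e. f v ^ Poly_Mapping.lookup e v)"
  by (simp add: mpoly_subst_eq_lin_ext)

lemma klinear_mpoly_subst: "klinear (mpoly_subst f)"
  by (simp add: mpoly_subst_eq_lin_ext klinear_lin_ext)

lemma mpoly_subst_Mon_add:
  "mpoly_subst f (Mon (d + e)) = mpoly_subst f (Mon d) * mpoly_subst f (Mon e)"
proof -
  let ?A = "Poly_Mapping.keys d \<union> Poly_Mapping.keys e"
  have *: "mpoly_subst f (Mon u) = (\<Prod>v\<in>?A. f v ^ Poly_Mapping.lookup u v)"
    if "Poly_Mapping.keys u \<subseteq> ?A" for u
    unfolding mpoly_subst_Mon using that
    by (intro prod.mono_neutral_left) (auto simp: in_keys_iff)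
  have "Poly_Mapping.keys (d + e) \<subseteq> ?A"
    by (rule Poly_Mapping.keys_add)
  then show ?thesis
    using *[of d] *[of e] *[of "d + e"] by (simp add: lookup_add power_add prod.distrib)
qed

text \<open>Both sides are bilinear in \<open>(p, q)\<close>, and on monomials the claim is
  \<open>mpoly_subst_Mon_add\<close>.\<close>

lemma mpoly_subst_mult: "mpoly_subst f (p * q) = mpoly_subst f p * mpoly_subst f q"
proof -
  let ?S = "mpoly_subst f"
  have lin: "klinear (\<lambda>p. ?S (r * p))" "klinear (\<lambda>p. ?S r * ?S p)" for r
    using klinear_comp[OF klinear_mpoly_subst klinear_mult_left[OF klinear_id]]
      klinear_mult_left[OF klinear_mpoly_subst] by blast+
  have "?S (Mon d * q) = ?S (Mon d) * ?S q" for d q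
  proof (rule klinear_eqI[OF lin(1)[of "Mon d"] lin(2)[of "Mon d"], of q])
    show "?S (Mon d * Mon e) = ?S (Mon d) * ?S (Mon e)" for e
      unfolding Mon_add[symmetric] by (rule mpoly_subst_Mon_add)
  qed
  then have "?S (q * Mon e) = ?S q * ?S (Mon e)" for e
    by (simp only: mult.commute[of q] mult.commute[of "?S q"])
  from klinear_eqI[OF lin(1)[of q] lin(2)[of q], OF this, of p] show ?thesis
    by (simp only: mult.commute[of p] mult.commute[of "?S p"])
qed

lemma mpoly_subst_Const [simp]: "mpoly_subst f (Const c) = Const c"
proof -
  have "mpoly_subst f (Const c * Mon 0) = Const c * mpoly_subst f (Mon 0)"
    using klinear_mpoly_subst unfolding klinear_def by blast
  also have "mpoly_subst f (Mon 0) = 1"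
    unfolding mpoly_subst_Mon by simp
  finally show ?thesis
    by simp
qed

lemma mpoly_subst_Var [simp]: "mpoly_subst f (Var v) = f v"
  using mpoly_subst_Mon[of f "Poly_Mapping.single v 1"] by (simp add: Mon_single)

lemma alg_hom_mpoly_subst: "alg_hom UNIV UNIV (mpoly_subst f)"
  using klinear_mpoly_subst unfolding alg_hom_UNIV_iff klinear_def
  by (auto simp: mpoly_subst_mult)

lemma alg_gen_zero: "0 \<in> alg_gen S"
  and alg_gen_one: "1 \<in> alg_gen S"
  using alg_gen.const[of 0 S] alg_gen.const[of 1 S] by simp_all

lemma alg_gen_sum: "(\<And>a. a \<in> A \<Longrightarrow> f a \<in> alg_gen S) \<Longrightarrow> sum f A \<in> alg_gen S"
  by (induction A rule: infinite_finite_induct) (simp_all add: alg_gen_zero alg_gen.add)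

lemma alg_gen_prod: "(\<And>a. a \<in> A \<Longrightarrow> f a \<in> alg_gen S) \<Longrightarrow> prod f A \<in> alg_gen S"
  by (induction A rule: infinite_finite_induct) (simp_all add: alg_gen_one alg_gen.mult)

lemma alg_gen_power: "p \<in> alg_gen S \<Longrightarrow> p ^ n \<in> alg_gen S"
  using alg_gen_prod[of "{..<n}" "\<lambda>_. p" S] by simp

lemma alg_gen_subset:
  assumes "S \<subseteq> alg_gen T"
  shows "alg_gen S \<subseteq> alg_gen T"
proof
  fix p assume "p \<in> alg_gen S"
  then show "p \<in> alg_gen T"
    by induction (use assms in \<open>auto intro: alg_gen.intros\<close>)
qed

lemma Mon_in_alg_gen: "Poly_Mapping.keys e \<subseteq> V \<Longrightarrow> Mon e \<in> alg_gen (Var ` V)"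
  unfolding Mon_eq_prod by (intro alg_gen_prod alg_gen_power alg_gen.gen) auto

lemma polys_eq_alg_gen: "polys V = alg_gen (Var ` V)"
proof (intro equalityI subsetI)
  fix p :: "('a, 'b) mpoly" assume "p \<in> polys V"
  then have "(\<Sum>e\<in>Poly_Mapping.keys p. Const (Poly_Mapping.lookup p e) * Mon e) \<in> alg_gen (Var ` V)"
    by (intro alg_gen_sum alg_gen.mult alg_gen.const Mon_in_alg_gen) (auto simp: polys_def)
  then show "p \<in> alg_gen (Var ` V)"
    by (simp flip: Mon_expansion)
next
  fix p :: "('a, 'b) mpoly" assume "p \<in> alg_gen (Var ` V)"
  then show "p \<in> polys V"
  proof induction
    case (const c)
    then show ?case by (auto simp: polys_def Const_def split: if_splits)
  next
    case (gen p)
    then show ?case by (auto simp: polys_def Var_def)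
  next
    case (add p q)
    then show ?case using Poly_Mapping.keys_add[of p q] by (auto simp: polys_def)
  next
    case (mult p q)
    show ?case
      unfolding polys_def
    proof (safe)
      fix e v assume e: "e \<in> Poly_Mapping.keys (p * q)" and v: "v \<in> Poly_Mapping.keys e"
      then obtain a c where "e = a + c" "a \<in> Poly_Mapping.keys p" "c \<in> Poly_Mapping.keys q"
        using keys_mult[of p q] by blast
      then show "v \<in> V"
        using mult.IH v Poly_Mapping.keys_add[of a c] unfolding polys_def by blast
    qed
  qed
qed

lemma alg_hom_eq_on_alg_gen:
  assumes "alg_hom A B f" "alg_hom A C g" "alg_gen S \<subseteq> A"
    and "\<And>s. s \<in> S \<Longrightarrow> f s = g s" and "p \<in> alg_gen S"
  shows "f p = g p"
  using assms(5)
proof induction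
  case (const c)
  show ?case using alg_hom_Const[OF assms(1)] alg_hom_Const[OF assms(2)] by simp
next
  case (gen p)
  then show ?case by (rule assms(4))
next
  case (add p q)
  then have "p \<in> A" "q \<in> A" using assms(3) by auto
  then show ?case using alg_hom_add[OF assms(1)] alg_hom_add[OF assms(2)] add.IH by simp
next
  case (mult p q)
  then have "p \<in> A" "q \<in> A" using assms(3) by auto
  then show ?case using alg_hom_mult[OF assms(1)] alg_hom_mult[OF assms(2)] mult.IH by simp
qed

lemma alg_hom_eq_on_polys:
  assumes "alg_hom (polys V) B f" "alg_hom (polys V) C g"
    and "\<And>v. v \<in> V \<Longrightarrow> f (Var v) = g (Var v)" and "p \<in> polys V"
  shows "f p = g p"
  by (rule alg_hom_eq_on_alg_gen[OF assms(1,2), of "Var ` V"])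
     (use assms(3,4) in \<open>auto simp: polys_eq_alg_gen\<close>)

lemma alg_hom_image_alg_gen:
  assumes "alg_hom UNIV UNIV f"
  shows "f ` alg_gen S = alg_gen (f ` S)"
proof (intro equalityI subsetI)
  fix r assume "r \<in> f ` alg_gen S"
  then obtain p where "p \<in> alg_gen S" and r: "r = f p" by blast
  from this(1) have "f p \<in> alg_gen (f ` S)"
    by induction (use assms in \<open>auto simp: alg_hom_UNIV_iff intro: alg_gen.intros\<close>)
  then show "r \<in> alg_gen (f ` S)" by (simp add: r)
next
  fix r assume "r \<in> alg_gen (f ` S)"
  then show "r \<in> f ` alg_gen S"
  proof induction
    case (const c)
    have "Const c = f (Const c)" using assms by (simp add: alg_hom_UNIV_iff)
    then show ?case by (rule image_eqI) (rule alg_gen.const)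
  next
    case (add p q)
    then obtain p' q' where "p = f p'" "q = f q'" "p' \<in> alg_gen S" "q' \<in> alg_gen S" by blast
    moreover have "f p' + f q' = f (p' + q')" using assms by (simp add: alg_hom_UNIV_iff)
    ultimately show ?case by (auto intro: alg_gen.add)
  next
    case (mult p q)
    then obtain p' q' where "p = f p'" "q = f q'" "p' \<in> alg_gen S" "q' \<in> alg_gen S" by blast
    moreover have "f p' * f q' = f (p' * q')" using assms by (simp add: alg_hom_UNIV_iff)
    ultimately show ?case by (auto intro: alg_gen.mult)
  qed (auto intro: alg_gen.gen)
qed

lemma mpoly_subst_image_polys: "mpoly_subst f ` polys V = alg_gen (f ` V)"
  by (simp add: polys_eq_alg_gen alg_hom_image_alg_gen[OF alg_hom_mpoly_subst] image_image)

text \<open>Identifies an action that is only specified on the variables: it is given by a substitution,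
  and as such extends to a linear map of all polynomials.\<close>

lemma mpoly_subst_eq_on_polys:
  assumes "alg_hom (polys V) B f" "\<And>v. v \<in> V \<Longrightarrow> f (Var v) = g v" "p \<in> polys V"
  shows "f p = mpoly_subst g p"
  by (rule alg_hom_eq_on_polys[OF assms(1) alg_hom_mono[OF alg_hom_mpoly_subst]])
     (use assms(2,3) in auto)

lemma mpoly_subst_mpoly_subst:
  "mpoly_subst g (mpoly_subst f p) = mpoly_subst (\<lambda>v. mpoly_subst g (f v)) p"
  by (rule mpoly_subst_eq_on_polys[of UNIV UNIV])
     (auto intro: alg_hom_mono[OF alg_hom_comp[OF alg_hom_mpoly_subst alg_hom_mpoly_subst]]
           simp: polys_def)

lemma mpoly_subst_cong:
  "(\<And>v. v \<in> V \<Longrightarrow> f v = g v) \<Longrightarrow> p \<in> polys V \<Longrightarrow> mpoly_subst f p = mpoly_subst g p"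
  by (rule mpoly_subst_eq_on_polys[of V UNIV]) (auto intro: alg_hom_mono[OF alg_hom_mpoly_subst])

lemma mpoly_subst_id: "mpoly_subst Var p = p"
  by (rule mpoly_subst_eq_on_polys[of UNIV UNIV "\<lambda>p. p", symmetric]) (auto simp: alg_hom_def polys_def)


section \<open>Linear maps acting on one block of variables\<close>

lift_definition restrict_exp :: "'v set \<Rightarrow> ('v \<Rightarrow>\<^sub>0 nat) \<Rightarrow> ('v \<Rightarrow>\<^sub>0 nat)" is
  "\<lambda>A e v. if v \<in> A then e v else 0"
  by (erule rev_finite_subset) auto

text \<open>An exponent vector in the variables \<open>x\<^sub>i\<^sub>j\<close> is the same as its part in block \<open>l\<close>, which
  \<open>slice_exp l\<close> reads off as an exponent vector in the \<open>y\<^sub>j\<close>, together with its part off block \<open>l\<close>.\<close>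

lift_definition slice_exp :: "nat \<Rightarrow> (nat \<times> nat \<Rightarrow>\<^sub>0 nat) \<Rightarrow> (nat \<Rightarrow>\<^sub>0 nat)" is
  "\<lambda>l e j. e (l, j)"
proof -
  fix l and e :: "nat \<times> nat \<Rightarrow> nat" assume "finite {v. e v \<noteq> 0}"
  then have "finite (snd ` {v. e v \<noteq> 0})" by simp
  then show "finite {j. e (l, j) \<noteq> 0}" by (rule rev_finite_subset) force
qed

lift_definition embed_exp :: "nat \<Rightarrow> (nat \<Rightarrow>\<^sub>0 nat) \<Rightarrow> (nat \<times> nat \<Rightarrow>\<^sub>0 nat)" is
  "\<lambda>l d v. if fst v = l then d (snd v) else 0"
proof -
  fix l and d :: "nat \<Rightarrow> nat" assume "finite {j. d j \<noteq> 0}"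
  then have "finite (Pair l ` {j. d j \<noteq> 0})" by simp
  then show "finite {v. (if fst v = l then d (snd v) else 0) \<noteq> 0}"
    by (rule rev_finite_subset) (force split: if_splits)
qed

lemmas lookup_exp = restrict_exp.rep_eq slice_exp.rep_eq embed_exp.rep_eq

abbreviation off_block :: "nat \<Rightarrow> (nat \<times> nat \<Rightarrow>\<^sub>0 nat) \<Rightarrow> (nat \<times> nat \<Rightarrow>\<^sub>0 nat)" where
  "off_block l \<equiv> restrict_exp {v. fst v \<noteq> l}"

lemma off_block_plus_embed: "off_block l e + embed_exp l (slice_exp l e) = e"
  by (rule poly_mapping_eqI) (auto simp: lookup_add lookup_exp)

lemma off_block_add_embed: "off_block l (off_block l e + embed_exp l d) = off_block l e"
  and slice_add_embed: "slice_exp l (off_block l e + embed_exp l d) = d"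
  by (rule poly_mapping_eqI, simp add: lookup_add lookup_exp)+

lemma klinear_in_block: "klinear (in_block l)"
  and alg_hom_in_block: "alg_hom UNIV UNIV (in_block l)"
  using klinear_mpoly_subst alg_hom_mpoly_subst by (auto simp: in_block_def[abs_def])

lemma in_block_Mon: "in_block l (Mon d) = Mon (embed_exp l d)"
proof -
  have "embed_exp l d =
      (\<Sum>j\<in>Poly_Mapping.keys d. Poly_Mapping.single (l, j) (Poly_Mapping.lookup d j))"
  proof (rule poly_mapping_eqI)
    fix v
    show "Poly_Mapping.lookup (embed_exp l d) v = Poly_Mapping.lookup
      (\<Sum>j\<in>Poly_Mapping.keys d. Poly_Mapping.single (l, j) (Poly_Mapping.lookup d j)) v"
      by (cases v) (auto simp: lookup_sum lookup_exp lookup_single when_def in_keys_iff)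
  qed
  then show ?thesis
    by (simp only: in_block_def mpoly_subst_Mon Mon_sum finite_keys Mon_single)
qed

lemma in_block_polys: "p \<in> polys Y \<Longrightarrow> in_block l p \<in> polys ({l} \<times> Y)"
proof -
  assume "p \<in> polys Y"
  then have "in_block l p \<in> alg_gen ((\<lambda>j. Var (l, j)) ` Y)"
    unfolding in_block_def mpoly_subst_image_polys[symmetric] by (rule imageI)
  also have "(\<lambda>j. Var (l, j)) ` Y = Var ` ({l} \<times> Y)" by auto
  finally show ?thesis by (simp add: polys_eq_alg_gen)
qed

text \<open>Under \<open>k[x] = k[x\<^sub>i\<^sub>j : i \<noteq> l] \<otimes> k[y]\<close>, where the second factor is the \<open>l\<close>-th block, \<open>blockwise l L\<close>
  is \<open>id \<otimes> L\<close>.\<close>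

definition blockwise ::
  "nat \<Rightarrow> ((nat, 'k::field) mpoly \<Rightarrow> (nat, 'k) mpoly) \<Rightarrow> (nat \<times> nat, 'k) mpoly \<Rightarrow> (nat \<times> nat, 'k) mpoly"
where
  "blockwise l L = lin_ext (\<lambda>e. Mon (off_block l e) * in_block l (L (Mon (slice_exp l e))))"

text \<open>The coefficient of the monomial \<open>u\<close> when a polynomial is expanded in the variables off block \<open>l\<close>,
  with coefficients in the polynomials of block \<open>l\<close>.\<close>

definition block_coeff ::
  "nat \<Rightarrow> (nat \<times> nat \<Rightarrow>\<^sub>0 nat) \<Rightarrow> (nat \<times> nat, 'k::field) mpoly \<Rightarrow> (nat, 'k) mpoly" where
  "block_coeff l u = lin_ext (\<lambda>e. if off_block l e = u then Mon (slice_exp l e) else 0)"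

lemma klinear_blockwise: "klinear (blockwise l L)"
  and klinear_block_coeff: "klinear (block_coeff l u)"
  by (simp_all add: blockwise_def block_coeff_def klinear_lin_ext)

lemma block_coeff_product:
  "block_coeff l u (Mon (off_block l e) * in_block l q) = (if off_block l e = u then q else 0)"
proof -
  have lin: "klinear (\<lambda>q::(nat, 'k::field) mpoly. if off_block l e = u then q else 0)"
    by (simp add: klinear_def)
  show ?thesis
  proof (rule klinear_eqI[OF klinear_comp[OF klinear_block_coeff
            klinear_mult_left[OF klinear_in_block]] lin])
    show "block_coeff l u (Mon (off_block l e) * in_block l (Mon d)) =
      (if off_block l e = u then Mon d else 0)" for d
      by (simp only: in_block_Mon Mon_add[symmetric] block_coeff_def lin_ext_Mon
          off_block_add_embed slice_add_embed)
  qed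
qed

lemma block_coeff_blockwise:
  assumes "klinear L"
  shows "block_coeff l u (blockwise l L p) = L (block_coeff l u p)"
proof (rule klinear_eqI[OF klinear_comp[OF klinear_block_coeff klinear_blockwise]
      klinear_comp[OF assms klinear_block_coeff]])
  fix e
  show "block_coeff l u (blockwise l L (Mon e)) = L (block_coeff l u (Mon e))"
    using klinear_zero[OF assms] by (simp add: blockwise_def block_coeff_product)
      (simp add: block_coeff_def)
qed

lemma lookup_block_coeff:
  "Poly_Mapping.lookup (block_coeff l (off_block l e) p) (slice_exp l e) = Poly_Mapping.lookup p e"
proof -
  have *: "off_block l e' = off_block l e \<and> slice_exp l e' = slice_exp l e \<longleftrightarrow> e' = e" for e'
    using off_block_plus_embed[of l e] off_block_plus_embed[of l e'] by auto
  have "Poly_Mapping.lookup (block_coeff l (off_block l e) p) (slice_exp l e) =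
    (\<Sum>e'\<in>Poly_Mapping.keys p. Poly_Mapping.lookup p e' *
       (if off_block l e' = off_block l e \<and> slice_exp l e' = slice_exp l e then 1 else 0))"
    by (auto simp: block_coeff_def lin_ext_def lookup_sum lookup_Mon intro!: sum.cong)
  also have "\<dots> = (\<Sum>e'\<in>Poly_Mapping.keys p. if e' = e then Poly_Mapping.lookup p e' else 0)"
    unfolding * by (intro sum.cong) auto
  also have "\<dots> = Poly_Mapping.lookup p e"
    by (simp add: in_keys_iff)
  finally show ?thesis .
qed

text \<open>A polynomial is determined by its coefficients with respect to block \<open>l\<close>, and
  \<open>blockwise l L\<close> applies \<open>L\<close> to each of them. Consequently, if \<open>L'\<close> fixes all
  common fixed points of some linear maps, then \<open>blockwise l L'\<close> fixes all common fixed points of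
  their blockwise versions.\<close>

lemma blockwise_fixed_iff:
  assumes "klinear L"
  shows "blockwise l L p = p \<longleftrightarrow> (\<forall>u. L (block_coeff l u p) = block_coeff l u p)"
proof
  assume "blockwise l L p = p"
  then show "\<forall>u. L (block_coeff l u p) = block_coeff l u p"
    using block_coeff_blockwise[OF assms, of l _ p] by simp
next
  assume *: "\<forall>u. L (block_coeff l u p) = block_coeff l u p"
  show "blockwise l L p = p"
  proof (rule poly_mapping_eqI)
    fix e
    have "Poly_Mapping.lookup (blockwise l L p) e =
        Poly_Mapping.lookup (block_coeff l (off_block l e) (blockwise l L p)) (slice_exp l e)"
      by (simp only: lookup_block_coeff)
    also have "\<dots> = Poly_Mapping.lookup p e"
      by (simp only: block_coeff_blockwise[OF assms] *[rule_format] lookup_block_coeff)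
    finally show "Poly_Mapping.lookup (blockwise l L p) e = Poly_Mapping.lookup p e" .
  qed
qed

lemma block_coeff_polys:
  assumes "p \<in> polys (I \<times> Y)"
  shows "block_coeff l u p \<in> polys Y"
proof -
  have "Poly_Mapping.keys (slice_exp l e) \<subseteq> Y" if "e \<in> Poly_Mapping.keys p" for e
  proof
    fix j assume "j \<in> Poly_Mapping.keys (slice_exp l e)"
    then have "(l, j) \<in> Poly_Mapping.keys e"
      by (simp add: in_keys_iff lookup_exp)
    then show "j \<in> Y" using assms that unfolding polys_def by blast
  qed
  then have "(if off_block l e = u then Mon (slice_exp l e) else 0) \<in> alg_gen (Var ` Y)"
    if "e \<in> Poly_Mapping.keys p" for e
    using that by (simp add: Mon_in_alg_gen alg_gen_zero)
  then show ?thesis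
    unfolding block_coeff_def lin_ext_def polys_eq_alg_gen
    by (intro alg_gen_sum alg_gen.mult alg_gen.const)
qed

text \<open>On monomials both sides factor into the part off block \<open>l\<close>, which is left alone, and the part in
  block \<open>l\<close>, where \<open>g\<close> is substituted. For \<open>g\<close> the linear substitution by \<open>h\<close> this is the action
  of \<open>\<alpha>\<^sup>(\<^sup>l\<^sup>)(h)\<close>.\<close>

lemma blockwise_mpoly_subst:
  "blockwise l (mpoly_subst g) p =
     mpoly_subst (\<lambda>(i, j). if i = l then in_block l (g j) else Var (i, j)) p"
    (is "_ = mpoly_subst ?G p")
proof (rule klinear_eqI[OF klinear_blockwise klinear_mpoly_subst])
  fix e
  have "mpoly_subst ?G (Mon (off_block l e)) = mpoly_subst Var (Mon (off_block l e))"
    unfolding mpoly_subst_Mon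
    by (intro prod.cong) (auto simp: in_keys_iff lookup_exp)
  moreover have "mpoly_subst ?G (in_block l q) = in_block l (mpoly_subst g q)" for q
    by (simp add: in_block_def mpoly_subst_mpoly_subst)
  ultimately have "mpoly_subst ?G (Mon (off_block l e) * in_block l (Mon (slice_exp l e))) =
      Mon (off_block l e) * in_block l (mpoly_subst g (Mon (slice_exp l e)))"
    by (simp add: mpoly_subst_mult mpoly_subst_id)
  also have "Mon (off_block l e) * in_block l (Mon (slice_exp l e)) = Mon e"
    by (simp add: in_block_Mon off_block_plus_embed flip: Mon_add)
  finally show "blockwise l (mpoly_subst g) (Mon e) = mpoly_subst ?G (Mon e)"
    by (simp add: blockwise_def)
qed

text \<open>Factors without variables of block \<open>l\<close> are scalars for \<open>blockwise l L\<close>.\<close>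

lemma blockwise_mult_Mon:
  assumes "p \<in> polys {v. fst v \<noteq> l}"
  shows "blockwise l L (p * Mon u) =
    p * (Mon (off_block l u) * in_block l (L (Mon (slice_exp l u))))"
proof -
  let ?q = "Mon (off_block l u) * in_block l (L (Mon (slice_exp l u)))"
  have lin: "klinear (\<lambda>p. blockwise l L (Mon u * p))"
    "klinear (\<lambda>p. ?q * p)"
    by (intro klinear_comp[OF klinear_blockwise] klinear_mult_left klinear_id)+
  have "blockwise l L (Mon u * p) = ?q * p"
  proof (rule klinear_eqI[OF lin])
    fix e assume "e \<in> Poly_Mapping.keys p"
    then have "Poly_Mapping.keys e \<subseteq> {v. fst v \<noteq> l}"
      using assms by (simp add: polys_def)
    then have e: "Poly_Mapping.lookup e (l, j) = 0" for j
      using in_keys_iff[of "(l, j)" e] by auto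
    have "off_block l (u + e) = off_block l u + e" "slice_exp l (u + e) = slice_exp l u"
      by (rule poly_mapping_eqI, use e in \<open>auto simp: lookup_add lookup_exp\<close>)+
    then show "blockwise l L (Mon u * Mon e) = ?q * Mon e"
      unfolding Mon_add[symmetric] blockwise_def lin_ext_Mon by (simp only: Mon_add mult_ac)
  qed
  then show ?thesis
    by (simp only: mult.commute[of p])
qed

text \<open>Apply \<open>blockwise l L\<close> to the monomial expansion of \<open>p\<close>, for one \<open>l \<in> I\<close> after the other. Each step
  leaves \<open>p\<close> unchanged and replaces the factor of every monomial in block \<open>l\<close> by its image under \<open>L\<close>.\<close>

lemma blockwise_fixed_expansion:
  assumes "finite I" and "\<And>l. l \<in> I \<Longrightarrow> blockwise l L p = p"
  shows "p = (\<Sum>e\<in>Poly_Mapping.keys p. Const (Poly_Mapping.lookup p e) *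
    ((\<Prod>i\<in>I. in_block i (L (Mon (slice_exp i e)))) * Mon (restrict_exp {v. fst v \<notin> I} e)))"
  using assms
proof (induction I rule: finite_induct)
  case empty
  have "restrict_exp {v. fst v \<notin> {}} e = e" for e :: "nat \<times> nat \<Rightarrow>\<^sub>0 nat"
    by (rule poly_mapping_eqI) (simp add: lookup_exp)
  then show ?case using Mon_expansion[of p] by simp
next
  case (insert l I)
  let ?c = "\<lambda>e. Const (Poly_Mapping.lookup p e)"
  let ?D = "\<lambda>I e. (\<Prod>i\<in>I. in_block i (L (Mon (slice_exp i e)))) * Mon (restrict_exp {v. fst v \<notin> I} e)"
  have step: "blockwise l L (?D I e) = ?D (insert l I) e" for e
  proof -
    have "in_block i q \<in> polys {v. fst v \<noteq> l}" if "i \<in> I" for i q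
    proof -
      have "in_block i q \<in> polys ({i} \<times> UNIV)"
        by (rule in_block_polys) (simp add: polys_def)
      moreover have "{i} \<times> UNIV \<subseteq> {v::nat \<times> nat. fst v \<noteq> l}"
        using that insert.hyps by auto
      ultimately show ?thesis
        unfolding polys_def by blast
    qed
    then have "(\<Prod>i\<in>I. in_block i (L (Mon (slice_exp i e)))) \<in> polys {v. fst v \<noteq> l}"
      unfolding polys_eq_alg_gen by (intro alg_gen_prod) auto
    note blockwise_mult_Mon[OF this, of L "restrict_exp {v. fst v \<notin> I} e"]
    moreover have "off_block l (restrict_exp {v. fst v \<notin> I} e) =
        restrict_exp {v. fst v \<notin> insert l I} e"
      by (rule poly_mapping_eqI) (simp add: lookup_exp)
    moreover have "slice_exp l (restrict_exp {v. fst v \<notin> I} e) = slice_exp l e"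
      using insert.hyps by (intro poly_mapping_eqI) (simp add: lookup_exp)
    ultimately show ?thesis
      using insert.hyps by (simp add: mult_ac)
  qed
  have IH: "p = (\<Sum>e\<in>Poly_Mapping.keys p. ?c e * ?D I e)"
    by (rule insert.IH) (simp add: insert.prems)
  have "p = blockwise l L p"
    by (simp add: insert.prems)
  also have "\<dots> = blockwise l L (\<Sum>e\<in>Poly_Mapping.keys p. ?c e * ?D I e)"
    by (rule arg_cong[OF IH])
  also have "\<dots> = (\<Sum>e\<in>Poly_Mapping.keys p. ?c e * blockwise l L (?D I e))"
    unfolding klinear_sum[OF klinear_blockwise]
    using klinear_blockwise[of l L] by (simp add: klinear_def)
  finally show ?case
    unfolding step .
qed

text \<open>A linear projection \<open>\<pi>\<close> onto the common fixed space of the substitutions fixes \<open>p\<close> on every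
  block in \<open>I\<close>. So \<open>p\<close> is a linear combination of products of values of \<open>\<pi>\<close>, one for each block.\<close>

theorem blockwise_invariants:
  fixes p :: "(nat \<times> nat, 'k::field) mpoly" and g :: "'h \<Rightarrow> nat \<Rightarrow> (nat, 'k) mpoly"
  assumes "finite I" and p: "p \<in> polys (I \<times> Y)"
    and fixed: "\<And>l h. l \<in> I \<Longrightarrow> h \<in> K \<Longrightarrow>
      mpoly_subst (\<lambda>(i, j). if i = l then in_block l (g h j) else Var (i, j)) p = p"
  shows "p \<in> alg_gen (\<Union>i\<in>I. in_block i ` {q \<in> polys Y. \<forall>h\<in>K. mpoly_subst (g h) q = q})"
proof -
  let ?V = "{q \<in> polys Y. \<forall>h\<in>K. mpoly_subst (g h) q = q}"
  have S: "mpoly_subst f (q + r) = mpoly_subst f q + mpoly_subst f r"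
    "mpoly_subst f (Const c * q) = Const c * mpoly_subst f q"
    for f :: "nat \<Rightarrow> (nat, 'k) mpoly" and c q r
    using klinear_mpoly_subst[of f] by (simp_all add: klinear_def)
  have "0 \<in> ?V"
    by (simp add: polys_eq_alg_gen alg_gen_zero klinear_zero[OF klinear_mpoly_subst])
  moreover have "q + r \<in> ?V" if "q \<in> ?V" "r \<in> ?V" for q r
    using that by (simp add: S polys_eq_alg_gen alg_gen.add)
  moreover have "Const c * q \<in> ?V" if "q \<in> ?V" for c q
    using that by (simp add: S polys_eq_alg_gen alg_gen.mult alg_gen.const)
  ultimately have "\<exists>\<pi>. klinear \<pi> \<and> (\<forall>q. \<pi> q \<in> ?V) \<and> (\<forall>q\<in>?V. \<pi> q = q)"
    by (rule klinear_projection)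
  then obtain \<pi> where \<pi>: "klinear \<pi>" "\<And>q. \<pi> q \<in> ?V" "\<And>q. q \<in> ?V \<Longrightarrow> \<pi> q = q"
    by blast
  have "blockwise l \<pi> p = p" if l: "l \<in> I" for l
  proof -
    have "blockwise l (mpoly_subst (g h)) p = p" if "h \<in> K" for h
      unfolding blockwise_mpoly_subst by (rule fixed[OF l that])
    then have "block_coeff l u p \<in> ?V" for u
      using block_coeff_polys[OF p]
      by (simp only: blockwise_fixed_iff[OF klinear_mpoly_subst] mem_Collect_eq) blast
    then show ?thesis
      unfolding blockwise_fixed_iff[OF \<pi>(1)] using \<pi>(3) by blast
  qed
  from blockwise_fixed_expansion[OF assms(1) this]
  have expansion: "p = (\<Sum>e\<in>Poly_Mapping.keys p. Const (Poly_Mapping.lookup p e) *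
    ((\<Prod>i\<in>I. in_block i (\<pi> (Mon (slice_exp i e)))) * Mon (restrict_exp {v. fst v \<notin> I} e)))"
    (is "_ = ?R") .
  have "restrict_exp {v. fst v \<notin> I} e = 0" if "e \<in> Poly_Mapping.keys p" for e
  proof (rule poly_mapping_eqI)
    fix v
    have "Poly_Mapping.keys e \<subseteq> I \<times> Y"
      using that p by (simp add: polys_def)
    then have "Poly_Mapping.lookup e v = 0" if "fst v \<notin> I"
      using that in_keys_iff[of v e] by auto
    then show "Poly_Mapping.lookup (restrict_exp {v. fst v \<notin> I} e) v = Poly_Mapping.lookup 0 v"
      by (simp add: lookup_exp)
  qed
  moreover have "in_block i (\<pi> q) \<in> alg_gen (\<Union>i\<in>I. in_block i ` ?V)" if "i \<in> I" for i q
    using \<pi>(2)[of q] that by (intro alg_gen.gen) blast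
  ultimately have "?R \<in> alg_gen (\<Union>i\<in>I. in_block i ` ?V)"
    by (intro alg_gen_sum alg_gen.mult[OF alg_gen.const] alg_gen.mult alg_gen_prod)
       (simp_all add: alg_gen_one)
  with expansion show ?thesis by simp
qed


section \<open>Wreath products and averaging\<close>

lemma mem_polys_mono: "p \<in> polys V \<Longrightarrow> V \<subseteq> W \<Longrightarrow> p \<in> polys W"
  unfolding polys_def by blast

text \<open>A function \<open>\<alpha>\<close> in the base group is a product of elements \<open>\<alpha>\<^sup>(\<^sup>l\<^sup>)(\<alpha>(l))\<close>, and \<open>(\<alpha>; g) = (\<alpha>; 1) (1; g)\<close>.\<close>

lemma fixed_ring_wreath_product:
  assumes H: "group H" and G: "group G" and "finite X"
    and one: "\<And>x. x \<in> X \<Longrightarrow> \<psi> \<one>\<^bsub>G\<^esub> x = x"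
    and action: "group_action (wreath_product H X G \<psi>) E \<tau>"
  shows "fixed_ring (wreath_product H X G \<psi>) E \<tau> =
    {p \<in> E. (\<forall>g\<in>carrier G. \<tau> (wreath_top H X g) p = p) \<and>
            (\<forall>l\<in>X. \<forall>h\<in>carrier H. \<tau> (wreath_base H X G l h) p = p)}"
    (is "_ = ?R")
proof -
  let ?W = "wreath_product H X G \<psi>"
  interpret H: group H by (rule H)
  interpret G: group G by (rule G)
  interpret group_action ?W E \<tau> by (rule action)
  have carr: "(\<alpha>, g) \<in> carrier ?W \<longleftrightarrow> \<alpha> \<in> X \<rightarrow>\<^sub>E carrier H \<and> g \<in> carrier G" for \<alpha> g
    by (simp add: wreath_product_def Let_def)
  have mult: "(\<alpha>, \<one>\<^bsub>G\<^esub>) \<otimes>\<^bsub>?W\<^esub> (\<beta>, g) = (\<lambda>x\<in>X. \<alpha> x \<otimes>\<^bsub>H\<^esub> \<beta> x, g)" if "g \<in> carrier G" for \<alpha> \<beta> g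
    using that one by (auto simp: wreath_product_def Let_def base_act_def intro!: restrict_ext)
  have top: "wreath_top H X g \<in> carrier ?W" if "g \<in> carrier G" for g
    using that by (simp add: wreath_top_def carr)
  have base: "wreath_base H X G l h \<in> carrier ?W" if "h \<in> carrier H" for l h
    using that by (auto simp: wreath_base_def carr)
  have "\<tau> (\<alpha>, g) p = p" if p: "p \<in> ?R" and \<alpha>: "\<alpha> \<in> X \<rightarrow>\<^sub>E carrier H" and g: "g \<in> carrier G" for \<alpha> g p
  proof -
    \<comment> \<open>the part of \<open>\<alpha>\<close> supported on \<open>S\<close>, built up one point at a time\<close>
    let ?\<beta> = "\<lambda>S. \<lambda>x\<in>X. if x \<in> S then \<alpha> x else \<one>\<^bsub>H\<^esub>"
    have \<beta>: "?\<beta> S \<in> X \<rightarrow>\<^sub>E carrier H" for S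
      using \<alpha> by (auto simp: PiE_iff)
    have "\<tau> (?\<beta> S, \<one>\<^bsub>G\<^esub>) p = p" if "finite S" "S \<subseteq> X" for S
      using that
    proof (induction S rule: finite_induct)
      case empty
      have "(?\<beta> {}, \<one>\<^bsub>G\<^esub>) = \<one>\<^bsub>?W\<^esub>"
        by (simp add: wreath_product_def Let_def)
      then show ?case
        using id_eq_one p by (metis (no_types, lifting) mem_Collect_eq restrict_apply')
    next
      case (insert l S)
      then have "\<alpha> l \<in> carrier H" "l \<in> X" using \<alpha> by auto
      have "(?\<beta> (insert l S), \<one>\<^bsub>G\<^esub>) = wreath_base H X G l (\<alpha> l) \<otimes>\<^bsub>?W\<^esub> (?\<beta> S, \<one>\<^bsub>G\<^esub>)"
        using insert.hyps \<alpha> unfolding wreath_base_def mult[OF G.one_closed]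
        by (auto intro!: restrict_ext simp: PiE_iff)
      also have "\<tau> \<dots> p = \<tau> (wreath_base H X G l (\<alpha> l)) (\<tau> (?\<beta> S, \<one>\<^bsub>G\<^esub>) p)"
        using p base[OF \<open>\<alpha> l \<in> carrier H\<close>] \<beta> by (intro composition_rule) (simp_all add: carr)
      also have "\<tau> (?\<beta> S, \<one>\<^bsub>G\<^esub>) p = p"
        using insert by blast
      also have "\<tau> (wreath_base H X G l (\<alpha> l)) p = p"
        using p \<open>\<alpha> l \<in> carrier H\<close> \<open>l \<in> X\<close> by blast
      finally show ?case .
    qed
    from this[OF \<open>finite X\<close> subset_refl] have "\<tau> (?\<beta> X, \<one>\<^bsub>G\<^esub>) p = p" .
    moreover have "?\<beta> X = \<alpha>"
      using \<alpha> by (auto simp: PiE_iff extensional_def)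
    ultimately have "\<tau> (\<alpha>, \<one>\<^bsub>G\<^esub>) p = p" by simp
    moreover have "(\<alpha>, g) = (\<alpha>, \<one>\<^bsub>G\<^esub>) \<otimes>\<^bsub>?W\<^esub> wreath_top H X g"
      using \<alpha> unfolding wreath_top_def mult[OF g]
      by (auto simp: PiE_iff extensional_def fun_eq_iff)
    moreover have "\<tau> ((\<alpha>, \<one>\<^bsub>G\<^esub>) \<otimes>\<^bsub>?W\<^esub> wreath_top H X g) p = \<tau> (\<alpha>, \<one>\<^bsub>G\<^esub>) (\<tau> (wreath_top H X g) p)"
      using p \<alpha> top[OF g] by (intro composition_rule) (simp_all add: carr)
    ultimately show ?thesis
      using p g by simp
  qed
  then have "?R \<subseteq> fixed_ring ?W E \<tau>"
    by (auto simp: fixed_ring_def carr)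
  then show ?thesis
    using top base by (auto simp: fixed_ring_def)
qed

text \<open>The average of \<open>q\<close> over \<open>\<Gamma>\<close> is invariant, and \<open>\<Phi>\<close> maps every \<open>\<sigma> g q\<close>, hence also their average,
  to \<open>\<Phi> q\<close>.\<close>

lemma invariant_image_by_averaging:
  fixes \<Phi> :: "('v, 'k::field) mpoly \<Rightarrow> ('w, 'k) mpoly"
  assumes action: "alg_action \<Gamma> (polys V) \<sigma>" and "finite (carrier \<Gamma>)"
    and order: "of_nat (card (carrier \<Gamma>)) \<noteq> (0::'k)"
    and \<Phi>: "klinear \<Phi>" and q: "q \<in> polys V"
    and inv: "\<And>g. g \<in> carrier \<Gamma> \<Longrightarrow> \<Phi> (\<sigma> g q) = \<Phi> q"
  shows "\<Phi> q \<in> \<Phi> ` fixed_ring \<Gamma> (polys V) \<sigma>"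
proof
  interpret group_action \<Gamma> "polys V" \<sigma>
    using action by (simp add: alg_action_def)
  interpret \<Gamma>: group \<Gamma>
    using group_hom group_hom.axioms(1) by blast
  let ?c = "Const (1 / of_nat (card (carrier \<Gamma>)))"
  let ?s = "\<Sum>g\<in>carrier \<Gamma>. \<sigma> g q"
  have \<sigma>q: "\<sigma> g q \<in> polys V" if "g \<in> carrier \<Gamma>" for g
    using element_image[OF that q] by blast
  then have s: "?c * ?s \<in> polys V"
    by (simp add: polys_eq_alg_gen alg_gen_sum alg_gen.mult alg_gen.const)
  have "\<sigma> h (?c * ?s) = ?c * ?s" if h: "h \<in> carrier \<Gamma>" for h
  proof -
    \<comment> \<open>\<open>\<sigma> h\<close> is linear on \<open>polys V\<close> only; \<open>?L\<close> is a linear map of all polynomials that agrees with it there\<close>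
    let ?L = "mpoly_subst (\<lambda>v. \<sigma> h (Var v))"
    have L: "\<sigma> h p = ?L p" if "p \<in> polys V" for p
      using action h that by (intro mpoly_subst_eq_on_polys[of V "polys V"]) (auto simp: alg_action_def)
    have "\<sigma> h (?c * ?s) = ?c * ?L ?s"
      unfolding L[OF s] using klinear_mpoly_subst unfolding klinear_def by blast
    also have "?L ?s = (\<Sum>g\<in>carrier \<Gamma>. ?L (\<sigma> g q))"
      by (rule klinear_sum[OF klinear_mpoly_subst])
    also have "\<dots> = (\<Sum>g\<in>carrier \<Gamma>. \<sigma> (h \<otimes>\<^bsub>\<Gamma>\<^esub> g) q)"
      using h q by (intro sum.cong) (simp_all add: composition_rule L[OF \<sigma>q])
    also have "\<dots> = ?s"
      using h by (intro sum.reindex_bij_betw[of "\<lambda>g. h \<otimes>\<^bsub>\<Gamma>\<^esub> g"])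
        (simp add: bij_betw_def \<Gamma>.inj_on_cmult \<Gamma>.surj_const_mult)
    finally show ?thesis .
  qed
  with s show "?c * ?s \<in> fixed_ring \<Gamma> (polys V) \<sigma>"
    by (simp add: fixed_ring_def)
  have "\<Phi> (?c * ?s) = ?c * \<Phi> ?s"
    using \<Phi> unfolding klinear_def by blast
  also have "\<Phi> ?s = (\<Sum>g\<in>carrier \<Gamma>. \<Phi> (\<sigma> g q))"
    by (rule klinear_sum[OF \<Phi>])
  also have "?c * \<dots> = ?c * (Const (of_nat (card (carrier \<Gamma>))) * \<Phi> q)"
    by (simp add: inv Const_of_nat)
  also have "\<dots> = \<Phi> q"
    using order by (simp flip: mult.assoc Const_mult)
  finally show "\<Phi> q = \<Phi> (?c * ?s)" by simp
qed


section \<open>Generators of the invariants of a wreath product\<close>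

theorem theorem2p6:
  fixes m n N M :: nat
    and G :: "(nat \<Rightarrow> nat) set"
    and H :: "'h monoid"
    and b :: "'h \<Rightarrow> nat \<Rightarrow> nat \<Rightarrow> 'k::field"
    and \<rho> :: "'h \<Rightarrow> (nat, 'k) mpoly \<Rightarrow> (nat, 'k) mpoly"
    and \<tau> :: "(nat \<Rightarrow> 'h) \<times> (nat \<Rightarrow> nat) \<Rightarrow> (nat \<times> nat, 'k) mpoly \<Rightarrow> (nat \<times> nat, 'k) mpoly"
    and \<sigma> :: "(nat \<Rightarrow> nat) \<Rightarrow> (nat \<times> nat, 'k) mpoly \<Rightarrow> (nat \<times> nat, 'k) mpoly"
    and F :: "nat \<Rightarrow> (nat, 'k) mpoly"
    and P :: "nat \<Rightarrow> (nat \<times> nat, 'k) mpoly"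
  assumes G_sub: "subgroup G (sym_group m)"
    and H_group: "group H"
    and H_fin: "finite (carrier H)"
    and b_GL: "\<forall>h \<in> carrier H. invertible_mat (mat n n (\<lambda>(l, j). b h (Suc l) (Suc j)))"
    and H_act: "alg_action H (polys {1..n}) \<rho>"
    and H_act_var: "\<forall>h \<in> carrier H. \<forall>j \<in> {1..n}.
          \<rho> h (Var j) = (\<Sum>l = 1..n. Const (b h l j) * Var l)"
    and W_act: "alg_action (wreath_product H {1..m} (sym_group m\<lparr>carrier := G\<rparr>) (\<lambda>g i. g i))
          (polys ({1..m} \<times> {1..n})) \<tau>"
    and W_act_top: "\<forall>g \<in> G. \<forall>i \<in> {1..m}. \<forall>j \<in> {1..n}.
          \<tau> (wreath_top H {1..m} g) (Var (i, j)) = Var (g i, j)"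
    and W_act_base: "\<forall>l \<in> {1..m}. \<forall>h \<in> carrier H. \<forall>i \<in> {1..m}. \<forall>j \<in> {1..n}.
          \<tau> (wreath_base H {1..m} (sym_group m\<lparr>carrier := G\<rparr>) l h) (Var (i, j)) =
            (if i = l then (\<Sum>t = 1..n. Const (b h t j) * Var (l, t)) else Var (i, j))"
    and char: "CHAR('k) = 0 \<or> \<not> CHAR('k) dvd card G"
    and N_ge: "N \<ge> n"
    and F_poly: "\<forall>t \<in> {1..N}. F t \<in> polys {1..n}"
    and F_gen: "fixed_ring H (polys {1..n}) \<rho> = alg_gen (F ` {1..N})"
    and G_act: "alg_action (sym_group m\<lparr>carrier := G\<rparr>) (polys ({1..m} \<times> {1..N})) \<sigma>"
    and G_act_var: "\<forall>g \<in> G. \<forall>i \<in> {1..m}. \<forall>t \<in> {1..N}. \<sigma> g (Var (i, t)) = Var (g i, t)"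
    and P_poly: "\<forall>s \<in> {1..M}. P s \<in> polys ({1..m} \<times> {1..N})"
    and P_gen: "fixed_ring (sym_group m\<lparr>carrier := G\<rparr>) (polys ({1..m} \<times> {1..N})) \<sigma> =
          alg_gen (P ` {1..M})"
  shows "fixed_ring (wreath_product H {1..m} (sym_group m\<lparr>carrier := G\<rparr>) (\<lambda>g i. g i))
           (polys ({1..m} \<times> {1..n})) \<tau> =
         alg_gen ((\<lambda>s. Phi F (P s)) ` {1..M})"
proof -
  let ?X = "{1..m}" and ?Y = "{1..n}" and ?\<Gamma> = "sym_group m\<lparr>carrier := G\<rparr>"
  let ?W = "wreath_product H ?X ?\<Gamma> (\<lambda>g i. g i)"
  let ?R = "polys (?X \<times> ?Y) :: (nat \<times> nat, 'k) mpoly set"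
  let ?Q = "polys (?X \<times> {1..N}) :: (nat \<times> nat, 'k) mpoly set"
  let ?\<Phi> = "Phi F"
  \<comment> \<open>The given actions are only known on their polynomial rings. \<open>mpoly_subst (\<beta> h)\<close>, \<open>B l h\<close> and \<open>T g\<close>
    are the substitutions that describe \<open>h\<close>, \<open>\<alpha>\<^sup>(\<^sup>l\<^sup>)(h)\<close> and \<open>g\<close> there.\<close>
  define \<beta> where "\<beta> h j = (\<Sum>t = 1..n. Const (b h t j) * Var t)" for h j
  define B where "B l h = mpoly_subst (\<lambda>(i, j). if i = l then in_block l (\<beta> h j) else Var (i, j))" for l h
  define T where "T g = mpoly_subst (\<lambda>(i, j). Var (g i, j) :: (nat \<times> nat, 'k) mpoly)" for g :: "nat \<Rightarrow> nat"
  have group: "group ?\<Gamma>"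
    using sym_group_is_group G_sub by (rule group.subgroup_imp_group)
  have action: "group_action ?W ?R \<tau>" and hom: "\<And>w. w \<in> carrier ?W \<Longrightarrow> alg_hom ?R ?R (\<tau> w)"
    using W_act by (simp_all add: alg_action_def)
  have \<Phi>: "alg_hom UNIV UNIV ?\<Phi>" "klinear ?\<Phi>"
    unfolding Phi_def by (rule alg_hom_mpoly_subst klinear_mpoly_subst)+

  have \<rho>_eq: "\<rho> h q = mpoly_subst (\<beta> h) q" if "h \<in> carrier H" "q \<in> polys ?Y" for h q
    using H_act H_act_var that
    by (intro mpoly_subst_eq_on_polys[of ?Y "polys ?Y"]) (simp_all add: alg_action_def \<beta>_def)
  have invariants: "{q \<in> polys ?Y. \<forall>h\<in>carrier H. mpoly_subst (\<beta> h) q = q} = alg_gen (F ` {1..N})"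
    unfolding F_gen[symmetric] fixed_ring_def using \<rho>_eq by auto
  have top_eq: "\<tau> (wreath_top H ?X g) p = T g p" if "g \<in> G" "p \<in> ?R" for g p
    unfolding T_def
  proof (rule mpoly_subst_eq_on_polys[OF hom _ that(2)])
    show "wreath_top H ?X g \<in> carrier ?W"
      using that H_group by (simp add: wreath_top_def wreath_product_def Let_def group.is_monoid)
    show "\<tau> (wreath_top H ?X g) (Var v) = (\<lambda>(i, j). Var (g i, j)) v" if "v \<in> ?X \<times> ?Y" for v
      using that \<open>g \<in> G\<close> W_act_top by auto
  qed
  have base_eq: "\<tau> (wreath_base H ?X ?\<Gamma> l h) p = B l h p"
    if "l \<in> ?X" "h \<in> carrier H" "p \<in> ?R" for l h p
    unfolding B_def
  proof (rule mpoly_subst_eq_on_polys[OF hom _ that(3)])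
    have "\<one>\<^bsub>?\<Gamma>\<^esub> \<in> G"
      using group.is_monoid[OF group] monoid.one_closed by fastforce
    then show "wreath_base H ?X ?\<Gamma> l h \<in> carrier ?W"
      using that H_group
      by (auto simp: wreath_base_def wreath_product_def Let_def group.is_monoid)
    have "in_block l (\<beta> h j) = (\<Sum>t = 1..n. Const (b h t j) * Var (l, t))" for j
      unfolding \<beta>_def klinear_sum[OF klinear_in_block]
      by (simp add: in_block_def mpoly_subst_mult)
    then show "\<tau> (wreath_base H ?X ?\<Gamma> l h) (Var v) =
        (\<lambda>(i, j). if i = l then in_block l (\<beta> h j) else Var (i, j)) v" if "v \<in> ?X \<times> ?Y" for v
      using that \<open>l \<in> ?X\<close> \<open>h \<in> carrier H\<close> W_act_base by auto
  qed
  have fixed_iff: "fixed_ring ?W ?R \<tau> =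
      {p \<in> ?R. (\<forall>g\<in>G. T g p = p) \<and> (\<forall>l\<in>?X. \<forall>h\<in>carrier H. B l h p = p)}"
    using fixed_ring_wreath_product[OF H_group group _ _ action] top_eq base_eq
    by (auto simp: sym_group_def)

  have image: "?\<Phi> ` ?Q = alg_gen (\<Union>i\<in>?X. in_block i ` alg_gen (F ` {1..N}))"
  proof -
    have "?\<Phi> ` ?Q = alg_gen ((\<lambda>(i, t). in_block i (F t)) ` (?X \<times> {1..N}))" (is "_ = alg_gen ?S")
      unfolding Phi_def by (rule mpoly_subst_image_polys)
    also have "\<dots> = alg_gen (\<Union>i\<in>?X. in_block i ` alg_gen (F ` {1..N}))" (is "_ = alg_gen ?T")
    proof
      have "?S \<subseteq> ?T" by (auto intro: alg_gen.gen)
      then show "alg_gen ?S \<subseteq> alg_gen ?T"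
        by (intro alg_gen_subset) (blast intro: alg_gen.gen)
      have "in_block i ` alg_gen (F ` {1..N}) \<subseteq> alg_gen ?S" if "i \<in> ?X" for i
        unfolding alg_hom_image_alg_gen[OF alg_hom_in_block] using that
        by (intro alg_gen_subset) (auto intro!: alg_gen.gen)
      then show "alg_gen ?T \<subseteq> alg_gen ?S"
        by (intro alg_gen_subset) blast
    qed
    finally show ?thesis .
  qed
  have \<Phi>_polys: "?\<Phi> q \<in> ?R" if "q \<in> ?Q" for q
  proof -
    have "in_block i p \<in> ?R" if "i \<in> ?X" "p \<in> alg_gen (F ` {1..N})" for i p
    proof (rule mem_polys_mono)
      show "in_block i p \<in> polys ({i} \<times> ?Y)"
        using that(2) unfolding F_gen[symmetric] fixed_ring_def by (intro in_block_polys) blast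
    qed (use that(1) in auto)
    then have "alg_gen (\<Union>i\<in>?X. in_block i ` alg_gen (F ` {1..N})) \<subseteq> ?R"
      unfolding polys_eq_alg_gen by (intro alg_gen_subset) blast
    then show ?thesis
      using that image by blast
  qed
  have \<Phi>_base: "B l h (?\<Phi> q) = ?\<Phi> q" if "q \<in> ?Q" "h \<in> carrier H" for l h q
  proof -
    have "B l h (in_block i (F t)) = in_block i (F t)" if "t \<in> {1..N}" for i t
    proof (cases "i = l")
      case True
      have "F t \<in> {q \<in> polys ?Y. \<forall>h\<in>carrier H. mpoly_subst (\<beta> h) q = q}"
        unfolding invariants using that by (intro alg_gen.gen) simp
      then have "in_block l (mpoly_subst (\<beta> h) (F t)) = in_block l (F t)"
        using \<open>h \<in> carrier H\<close> by simp
      then show ?thesis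
        by (simp add: B_def True in_block_def mpoly_subst_mpoly_subst)
    qed (simp add: B_def in_block_def mpoly_subst_mpoly_subst)
    then show ?thesis
      unfolding Phi_def B_def mpoly_subst_mpoly_subst
      by (intro mpoly_subst_cong[OF _ that(1)]) auto
  qed
  have \<Phi>_top: "?\<Phi> (\<sigma> g q) = T g (?\<Phi> q)" if "g \<in> G" "q \<in> ?Q" for g q
  proof -
    have "\<sigma> g q = T g q"
      unfolding T_def using that G_act G_act_var
      by (intro mpoly_subst_eq_on_polys[of _ ?Q]) (auto simp: alg_action_def)
    moreover have "?\<Phi> (T g q) = T g (?\<Phi> q)"
      unfolding Phi_def T_def mpoly_subst_mpoly_subst
      by (rule arg_cong[of _ _ "\<lambda>f. mpoly_subst f q"])
         (auto simp: fun_eq_iff in_block_def mpoly_subst_mpoly_subst)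
    ultimately show ?thesis by simp
  qed

  have "finite G"
    using subgroup.subset[OF G_sub] finite_permutations[of ?X]
    by (auto simp: sym_group_def intro: finite_subset)
  moreover have "G \<noteq> {}"
    using subgroup.one_closed[OF G_sub] by blast
  ultimately have order: "of_nat (card G) \<noteq> (0::'k)"
    using char by (auto simp: of_nat_eq_0_iff_char_dvd)

  have "fixed_ring ?W ?R \<tau> = ?\<Phi> ` fixed_ring ?\<Gamma> ?Q \<sigma>"
  proof (intro equalityI subsetI)
    fix p assume "p \<in> fixed_ring ?W ?R \<tau>"
    then have p: "p \<in> ?R" and top: "\<And>g. g \<in> G \<Longrightarrow> T g p = p"
      and base: "\<And>l h. l \<in> ?X \<Longrightarrow> h \<in> carrier H \<Longrightarrow> B l h p = p"
      unfolding fixed_iff by auto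
    have "p \<in> ?\<Phi> ` ?Q"
      unfolding image invariants[symmetric]
      using base by (intro blockwise_invariants p) (simp_all add: B_def)
    then obtain q where q: "q \<in> ?Q" "p = ?\<Phi> q" by blast
    show "p \<in> ?\<Phi> ` fixed_ring ?\<Gamma> ?Q \<sigma>"
      unfolding q(2)
    proof (rule invariant_image_by_averaging[OF G_act _ _ \<Phi>(2) q(1)])
      show "?\<Phi> (\<sigma> g q) = ?\<Phi> q" if "g \<in> carrier ?\<Gamma>" for g
        using that \<Phi>_top[of g q] top[of g] q by simp
    qed (use \<open>finite G\<close> order in simp_all)
  next
    fix p assume "p \<in> ?\<Phi> ` fixed_ring ?\<Gamma> ?Q \<sigma>"
    then obtain q where "q \<in> fixed_ring ?\<Gamma> ?Q \<sigma>" and p: "p = ?\<Phi> q" by blast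
    then have q: "q \<in> ?Q" "\<And>g. g \<in> G \<Longrightarrow> \<sigma> g q = q"
      by (simp_all add: fixed_ring_def)
    have "T g (?\<Phi> q) = ?\<Phi> q" if "g \<in> G" for g
      using \<Phi>_top[OF that q(1)] q(2)[OF that] by simp
    then show "p \<in> fixed_ring ?W ?R \<tau>"
      unfolding fixed_iff p using \<Phi>_polys[OF q(1)] \<Phi>_base[OF q(1)] by blast
  qed
  also have "\<dots> = alg_gen ((\<lambda>s. ?\<Phi> (P s)) ` {1..M})"
    unfolding P_gen alg_hom_image_alg_gen[OF \<Phi>(1)] by (simp add: image_image)
  finally show ?thesis .
qed

end
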